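(* Let $\{a_n\}$ be a strictly increasing sequence of real numbers such that the set of integers $\{\lfloor a_n \rfloor\}$ has positive upper Banach density. Then, for any $\delta > 0$ and any sequence of intervals $\{\Delta_n\}$ with length $\delta$, the set $$X = \{x \in \mathbb{R} : a_n x \notin \Delta_n \pmod 1 \text{ for all } n \in \mathbb{N}\}$$ is countable.
   Context: $\lfloor x \rfloor$ denotes the largest integer not exceeding $x$. A set $A \subset \mathbb{Z}$ has positive upper Banach density if $\limsup_{n \to \infty} \max_h \frac{\#(A \cap \{h+1, h+2, \ldots, h+n\})}{n} > 0$, where $h$ ranges over the integers and $\#$ denotes cardinality. For an interval $\Delta$ and a real number $y$, $y \notin \Delta \pmod 1$ means $y \notin \mathbb{Z} + \Delta$. "Countable" means finite or countably infinite. *)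

theory Defs
  imports "HOL-Analysis.Analysis" "HOL-Library.Set_Algebras"
begin

text \<open>For fixed \<open>n\<close> the counts lie in \<open>{0..n}\<close>, so the maximum over all integers \<open>h\<close>
  is the maximum of a finite nonempty set. The term at \<open>n = 0\<close> does not influence the limsup.\<close>

definition upper_Banach_density :: "int set \<Rightarrow> ereal" where
  "upper_Banach_density A =
     limsup (\<lambda>n. ereal (real (Max (range (\<lambda>h. card (A \<inter> {h + 1..h + int n})))) / real n))"

text \<open>Either endpoint may or may not belong to the interval.\<close>

definition interval_of_length :: "real \<Rightarrow> real set \<Rightarrow> bool" where
  "interval_of_length d I \<longleftrightarrow>
     (\<exists>l u. u - l = d \<and> (I = {l..u} \<or> I = {l..<u} \<or> I = {l<..u} \<or> I = {l<..<u}))"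

end

theory Submission imports Defs begin

text \<open>
  The set meets every bounded interval \<open>[-R, R]\<close> in a \<^emph>\<open>finite\<close> set, so it is countable. The reason is
  that distinct frequencies are nearly orthogonal over long windows of integers, while many points
  that all avoid an arc of fixed length are positively correlated.

  \<^item> \<^emph>\<open>Rescaling.\<close> Put \<open>r = \<lfloor>L a\<^sub>n\<rfloor>\<close> and \<open>y = x / L\<close> for a large integer \<open>L\<close>. Then \<open>r y\<close> is within \<open>R / L\<close>
    of \<open>a\<^sub>n x\<close>, so it stays at distance at least \<open>\<delta> / 4\<close> from the centre \<open>c\<close> of the interval
    \<open>\<Delta>\<^sub>n\<close> modulo 1. The integers \<open>r\<close> still fill a positive proportion of arbitrarily long windows
    (\<open>card_window_floor_le\<close>), and the numbers \<open>y\<close> now lie in a very short interval.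

  \<^item> \<^emph>\<open>Avoiding an arc forces a bias.\<close> If \<open>t\<close> is bounded away from the integers, the geometric sum
    \<open>\<Sum>j<K. e(j t)\<close> is bounded independently of \<open>K\<close>. Its squared modulus is \<open>K\<close> plus the sum
    of \<open>e((i - j) t)\<close> over \<open>i \<noteq> j\<close>, so for large \<open>K\<close> the latter is at most \<open>- K / 2\<close>
    (this is a Fejer kernel away from its peak). Taking \<open>t = r y - c\<close>, adding over \<open>k\<close> numbers \<open>y\<close>
    and applying Cauchy-Schwarz gives a lower bound of order \<open>k\<^sup>2\<close> for
    \<open>\<Sum>i\<noteq>j. |S\<^bsub>i-j\<^esub>(r)|\<^sup>2\<close>, where \<open>S\<^bsub>q\<^esub>(r) = \<Sum>y. e(q r y)\<close>
    (\<open>card_square_le_sum_norm_square\<close>). The centre \<open>c\<close> enters \<open>S\<^bsub>q\<^esub>\<close> only through a unimodular factor,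
    which is why it may depend on \<open>r\<close> in an arbitrary way.

  \<^item> \<^emph>\<open>Near orthogonality.\<close> Over a whole window of \<open>N\<close> integers the sum of \<open>|S\<^bsub>q\<^esub>(r)|\<^sup>2\<close> is
    \<open>k N + O(1)\<close> as soon as no \<open>q (y - z)\<close> with \<open>y \<noteq> z\<close> is an integer
    (\<open>mean_square_window_le\<close>). For \<open>0 < |q| < K\<close> this is guaranteed by \<open>|y - z| < 1 / K\<close>, which
    the rescaling provides.

  Comparing the two bounds on a dense window of length \<open>N\<close> and letting \<open>N\<close> tend to infinity leaves
  \<open>k\<^sup>2 = O(k)\<close>, that is, a bound on the number of points.
\<close>

section \<open>Additive characters and geometric sums\<close>

definition e :: "real \<Rightarrow> complex" where
  "e t = cis (2 * pi * t)"

lemma norm_e [simp]: "norm (e t) = 1"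
  by (simp add: e_def)

lemma e_add: "e (s + t) = e s * e t"
  by (simp add: e_def cis_mult distrib_left)

lemma e_diff: "e (s - t) = e s * cnj (e t)"
  by (simp add: e_def cis_cnj cis_mult right_diff_distrib)

lemma e_of_nat_mult: "e (of_nat j * t) = e t ^ j"
  unfolding e_def Complex.DeMoivre by (simp only: mult_ac)

lemma e_eq_1_imp_Ints:
  assumes "e t = 1"
  shows "t \<in> \<int>"
proof -
  have "cos (2 * pi * t) = 1"
    using arg_cong[OF assms, of Re] by (simp add: e_def)
  then obtain n :: int where "2 * pi * t = of_int n * 2 * pi"
    by (auto simp: cos_one_2pi_int)
  then have "t = of_int n" by simp
  then show ?thesis by simp
qed

lemma norm_geometric_sum_e_le:
  assumes "e t \<noteq> 1"
  shows "norm (\<Sum>j<n. e (of_nat j * t)) \<le> 2 / norm (1 - e t)"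
proof -
  have "(\<Sum>j<n. e (of_nat j * t)) = (1 - e t ^ n) / (1 - e t)"
    using assms by (simp add: e_of_nat_mult sum_gp_strict)
  moreover have "norm (1 - e t ^ n) \<le> 2"
    using norm_triangle_ineq4[of 1 "e t ^ n"] by (simp add: norm_power)
  ultimately show ?thesis
    by (simp add: norm_divide divide_right_mono)
qed

lemma norm_window_sum_e_le:
  assumes "e t \<noteq> 1"
  shows "norm (\<Sum>r\<in>{h + 1..h + int n}. e (of_int r * t)) \<le> 2 / norm (1 - e t)"
proof -
  have "(\<Sum>r\<in>{h + 1..h + int n}. e (of_int r * t))
      = (\<Sum>j<n. e (of_int (h + 1) * t) * e (of_nat j * t))"
    by (rule sum.reindex_bij_witness[of _ "\<lambda>j. h + 1 + int j" "\<lambda>r. nat (r - h - 1)"])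
       (auto simp: e_add[symmetric] algebra_simps)
  also have "\<dots> = e (of_int (h + 1) * t) * (\<Sum>j<n. e (of_nat j * t))"
    by (simp add: sum_distrib_left)
  finally show ?thesis
    using norm_geometric_sum_e_le[OF assms, of n] by (simp add: norm_mult)
qed

text \<open>The nearest integer to \<open>t\<close> is at a distance between \<open>\<eta>\<close> and \<open>1 / 2\<close>, and cosine decreases
  on \<open>[0, \<pi>]\<close>.\<close>

lemma norm_one_minus_e_ge:
  assumes "0 \<le> \<eta>" and "\<And>k :: int. \<eta> \<le> \<bar>t - of_int k\<bar>"
  shows "1 - cos (2 * pi * \<eta>) \<le> norm (1 - e t)"
proof -
  define u where "u = \<bar>t - of_int (round t)\<bar>"
  have u: "\<eta> \<le> u" "u \<le> 1 / 2"
    using assms(2)[of "round t"] of_int_round_abs_le[of t] by (auto simp: u_def abs_minus_commute)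
  have "cos (2 * pi * t) = cos (2 * pi * (t - of_int (round t)))"
    using cos.plus_of_int[of "2 * pi * t" "- round t"]
    by (simp add: algebra_simps)
  also have "\<dots> = cos (2 * pi * u)"
  proof -
    have "2 * pi * u = \<bar>2 * pi * (t - of_int (round t))\<bar>"
      by (simp add: u_def abs_mult)
    then show ?thesis by simp
  qed
  also have "\<dots> \<le> cos (2 * pi * \<eta>)"
    using u assms(1) by (intro cos_monotone_0_pi_le) auto
  finally have "1 - cos (2 * pi * \<eta>) \<le> Re (1 - e t)"
    by (simp add: e_def)
  also have "\<dots> \<le> norm (1 - e t)"
    by (rule complex_Re_le_cmod)
  finally show ?thesis .
qed

lemma norm_square_sum_unit:
  fixes f :: "'a \<Rightarrow> complex"
  assumes "finite J" and unit: "\<And>j. j \<in> J \<Longrightarrow> norm (f j) = 1"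
  shows "of_real ((norm (\<Sum>j\<in>J. f j))\<^sup>2)
       = of_nat (card J) + (\<Sum>(i, j)\<in>J \<times> J - Id. f i * cnj (f j))"
proof -
  have "of_real ((norm (\<Sum>j\<in>J. f j))\<^sup>2) = (\<Sum>j\<in>J. f j) * cnj (\<Sum>j\<in>J. f j)"
    by (rule complex_norm_square)
  also have "\<dots> = (\<Sum>(i, j)\<in>J \<times> J. f i * cnj (f j))"
    by (simp add: sum_product sum.cartesian_product)
  also have "\<dots> = (\<Sum>(i, j)\<in>J \<times> J - Id. f i * cnj (f j))
                + (\<Sum>(i, j)\<in>(\<lambda>j. (j, j)) ` J. f i * cnj (f j))"
  proof -
    have "J \<times> J - Id = J \<times> J - (\<lambda>j. (j, j)) ` J" by auto
    then show ?thesis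
      using assms(1) by (simp only:) (rule sum.subset_diff; auto)
  qed
  also have "(\<Sum>(i, j)\<in>(\<lambda>j. (j, j)) ` J. f i * cnj (f j)) = (\<Sum>j\<in>J. f j * cnj (f j))"
    by (subst sum.reindex) (auto simp: inj_on_def)
  also have "\<dots> = of_nat (card J)"
    using unit by (simp add: complex_norm_square[symmetric])
  finally show ?thesis by simp
qed

section \<open>Mean squares of exponential sums over windows of integers\<close>

text \<open>Expanding the square, the diagonal contributes \<open>card Y * n\<close>, and each of the finitely many
  off-diagonal pairs contributes a geometric sum with ratio different from 1, which is bounded
  uniformly in the window. The constant \<open>C\<close> may be huge if \<open>q * (y - z)\<close> comes close to an integer;
  it only has to be independent of \<open>h\<close> and \<open>n\<close>.\<close>

lemma mean_square_window_le:
  fixes Y :: "real set"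
  assumes "finite Y"
    and nonint: "\<And>y z. y \<in> Y \<Longrightarrow> z \<in> Y \<Longrightarrow> y \<noteq> z \<Longrightarrow> q * (y - z) \<notin> \<int>"
  shows "\<exists>C. \<forall>h n. (\<Sum>r\<in>{h + 1..h + int n}. (norm (\<Sum>y\<in>Y. e (q * (of_int r * y))))\<^sup>2)
                    \<le> real (card Y) * real n + C"
proof -
  have "(\<Sum>r\<in>{h + 1..h + int n}. (norm (\<Sum>y\<in>Y. e (q * (of_int r * y))))\<^sup>2)
      \<le> real (card Y) * real n + (\<Sum>(y, z)\<in>Y \<times> Y - Id. 2 / norm (1 - e (q * (y - z))))"
    for h :: int and n :: nat
  proof -
    define W where "W = {h + 1..h + int n}"
    have "complex_of_real (\<Sum>r\<in>W. (norm (\<Sum>y\<in>Y. e (q * (of_int r * y))))\<^sup>2)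
        = (\<Sum>r\<in>W. of_nat (card Y)
              + (\<Sum>(y, z)\<in>Y \<times> Y - Id. e (q * (of_int r * y)) * cnj (e (q * (of_int r * z)))))"
      unfolding of_real_sum by (intro sum.cong refl norm_square_sum_unit assms(1)) simp
    also have "\<dots> = of_nat (card Y) * of_nat n
          + (\<Sum>r\<in>W. \<Sum>(y, z)\<in>Y \<times> Y - Id. e (of_int r * (q * (y - z))))"
      by (simp add: sum.distrib W_def e_diff[symmetric] algebra_simps)
    also have "(\<Sum>r\<in>W. \<Sum>(y, z)\<in>Y \<times> Y - Id. e (of_int r * (q * (y - z))))
          = (\<Sum>(y, z)\<in>Y \<times> Y - Id. \<Sum>r\<in>W. e (of_int r * (q * (y - z))))"
      by (subst sum.swap) (simp add: case_prod_unfold)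
    finally have eq: "complex_of_real (\<Sum>r\<in>W. (norm (\<Sum>y\<in>Y. e (q * (of_int r * y))))\<^sup>2)
        = of_nat (card Y) * of_nat n
          + (\<Sum>(y, z)\<in>Y \<times> Y - Id. \<Sum>r\<in>W. e (of_int r * (q * (y - z))))" .
    have "norm (\<Sum>(y, z)\<in>Y \<times> Y - Id. \<Sum>r\<in>W. e (of_int r * (q * (y - z))))
        \<le> (\<Sum>(y, z)\<in>Y \<times> Y - Id. 2 / norm (1 - e (q * (y - z))))"
    proof (rule order.trans[OF norm_sum], rule sum_mono)
      fix p assume "p \<in> Y \<times> Y - Id"
      then obtain y z where p: "p = (y, z)" and "y \<in> Y" "z \<in> Y" "y \<noteq> z" by auto
      then have "e (q * (y - z)) \<noteq> 1"
        using nonint e_eq_1_imp_Ints by blast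
      then show "norm (case p of (y, z) \<Rightarrow> \<Sum>r\<in>W. e (of_int r * (q * (y - z))))
          \<le> (case p of (y, z) \<Rightarrow> 2 / norm (1 - e (q * (y - z))))"
        unfolding W_def p prod.case by (rule norm_window_sum_e_le)
    qed
    moreover have "(\<Sum>r\<in>W. (norm (\<Sum>y\<in>Y. e (q * (of_int r * y))))\<^sup>2)
        = real (card Y) * real n
          + Re (\<Sum>(y, z)\<in>Y \<times> Y - Id. \<Sum>r\<in>W. e (of_int r * (q * (y - z))))"
      using arg_cong[OF eq, of Re] by simp
    ultimately show ?thesis
      using complex_Re_le_cmod[of "\<Sum>(y, z)\<in>Y \<times> Y - Id. \<Sum>r\<in>W. e (of_int r * (q * (y - z)))"]
      unfolding W_def by linarith
  qed
  then show ?thesis by blast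
qed

section \<open>Points avoiding an arc\<close>

lemma card_off_diagonal_le: "real (card ({..<K} \<times> {..<K} - Id)) \<le> (real K)\<^sup>2"
proof -
  have "card ({..<K} \<times> {..<K} - Id) \<le> card ({..<K} \<times> {..<K})"
    by (intro card_mono) auto
  then have "card ({..<K} \<times> {..<K} - Id) \<le> K\<^sup>2" by (simp add: power2_eq_square)
  then show ?thesis
    by (metis of_nat_le_iff of_nat_power)
qed

text \<open>The full double sum over \<open>i\<close> and \<open>j\<close> is the squared modulus of a geometric sum, at most
  \<open>4 / s\<^sup>2 \<le> K / 2\<close>, while its diagonal alone contributes \<open>K\<close>. So the off-diagonal terms must cancel
  at least half of the diagonal.\<close>

lemma Re_off_diagonal_sum_le:
  assumes "0 < s" and far: "s \<le> norm (1 - e t)" and K: "8 / s\<^sup>2 \<le> real K"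
  shows "Re (\<Sum>(i, j)\<in>{..<K} \<times> {..<K} - Id. e ((real i - real j) * t)) \<le> - (real K / 2)"
proof -
  have "e t \<noteq> 1" using assms(1,2) by auto
  have "norm (\<Sum>j<K. e (of_nat j * t)) \<le> 2 / norm (1 - e t)"
    by (rule norm_geometric_sum_e_le) fact
  also have "\<dots> \<le> 2 / s"
    using assms(1,2) by (simp add: frac_le)
  finally have "(norm (\<Sum>j<K. e (of_nat j * t)))\<^sup>2 \<le> (2 / s)\<^sup>2"
    by (rule power_mono) simp
  also have "\<dots> \<le> real K / 2"
    using K by (simp add: power_divide)
  finally have small: "(norm (\<Sum>j<K. e (of_nat j * t)))\<^sup>2 \<le> real K / 2" .
  have "complex_of_real ((norm (\<Sum>j<K. e (of_nat j * t)))\<^sup>2)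
      = of_nat (card {..<K}) + (\<Sum>(i, j)\<in>{..<K} \<times> {..<K} - Id. e (of_nat i * t) * cnj (e (of_nat j * t)))"
    by (rule norm_square_sum_unit) auto
  from arg_cong[OF this, of Re] small show ?thesis
    by (simp add: e_diff[symmetric] left_diff_distrib)
qed

text \<open>If no \<open>y * r\<close> is near \<open>c\<close> modulo 1, the exponential sums over \<open>Y\<close> cannot all be small. Adding the
  preceding bound over \<open>Y\<close> shows that the moduli of these sums add up to at least \<open>card Y * K / 2\<close>,
  the shift \<open>c\<close> being absorbed in unimodular factors. Cauchy-Schwarz over the at most
  \<open>K\<^sup>2\<close> pairs turns this into a bound for the squares, which is what orthogonality controls.\<close>

lemma card_square_le_sum_norm_square:
  fixes Y :: "real set"
  assumes "finite Y" and "0 < s" and K: "8 / s\<^sup>2 \<le> real K"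
    and far: "\<And>y. y \<in> Y \<Longrightarrow> s \<le> norm (1 - e (y * r - c))"
  shows "(real (card Y))\<^sup>2 / 4
       \<le> (\<Sum>(i, j)\<in>{..<K} \<times> {..<K} - Id. (norm (\<Sum>y\<in>Y. e ((real i - real j) * (r * y))))\<^sup>2)"
proof -
  define P where "P = {..<K} \<times> {..<K} - Id"
  define S where "S = (\<lambda>(i, j). \<Sum>y\<in>Y. e ((real i - real j) * (r * y)))"
  have "0 < real K" using assms(2) K by (smt (verit) divide_pos_pos zero_less_power)
  have cardP: "real (card P) \<le> (real K)\<^sup>2"
    unfolding P_def by (rule card_off_diagonal_le)
  have "(\<Sum>y\<in>Y. Re (\<Sum>(i, j)\<in>P. e ((real i - real j) * (y * r - c)))) \<le> (\<Sum>y\<in>Y. - (real K / 2))"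
    unfolding P_def by (intro sum_mono Re_off_diagonal_sum_le[OF assms(2)] far K)
  then have "real (card Y) * (real K / 2)
      \<le> - Re (\<Sum>y\<in>Y. \<Sum>(i, j)\<in>P. e ((real i - real j) * (y * r - c)))"
    by simp
  also have "(\<Sum>y\<in>Y. \<Sum>(i, j)\<in>P. e ((real i - real j) * (y * r - c)))
      = (\<Sum>p\<in>P. e (- ((real (fst p) - real (snd p)) * c)) * S p)"
    unfolding S_def
    by (subst sum.swap) (auto simp: sum_distrib_left e_add[symmetric] algebra_simps intro!: sum.cong)
  also have "- Re \<dots> \<le> norm \<dots>"
    using abs_Re_le_cmod by (smt (verit))
  also have "\<dots> \<le> (\<Sum>p\<in>P. norm (S p))"
    by (rule order.trans[OF norm_sum]) (simp add: norm_mult)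
  finally have "(real (card Y) * (real K / 2))\<^sup>2 \<le> (\<Sum>p\<in>P. 1 * norm (S p))\<^sup>2"
    by (intro power_mono) auto
  also have "\<dots> \<le> (\<Sum>p\<in>P. 1\<^sup>2) * (\<Sum>p\<in>P. (norm (S p))\<^sup>2)"
    by (rule Cauchy_Schwarz_ineq_sum)
  also have "\<dots> \<le> (real K)\<^sup>2 * (\<Sum>p\<in>P. (norm (S p))\<^sup>2)"
    using cardP by (simp add: mult_right_mono sum_nonneg)
  finally have "(real K)\<^sup>2 * ((real (card Y))\<^sup>2 / 4) \<le> (real K)\<^sup>2 * (\<Sum>p\<in>P. (norm (S p))\<^sup>2)"
    by (simp add: power_mult_distrib power_divide mult_ac)
  then have "(real (card Y))\<^sup>2 / 4 \<le> (\<Sum>p\<in>P. (norm (S p))\<^sup>2)"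
    using \<open>0 < real K\<close> by simp
  then show ?thesis
    by (simp add: P_def S_def case_prod_unfold)
qed

text \<open>Each element of \<open>B\<close> in a window carries a sum of squares of at least \<open>(card Y)\<^sup>2 / 4\<close>, and by
  nonnegativity the sum over \<open>B\<close> is at most the sum over the whole window. The closeness of the
  points of \<open>Y\<close> makes every \<open>q * (y - z)\<close> with \<open>0 < \<bar>q\<bar> < K\<close> and \<open>y \<noteq> z\<close> a nonzero number of absolute value
  less than 1, hence not an integer, so that the frequencies are nearly orthogonal.\<close>

lemma card_window_avoiding_le:
  fixes Y :: "real set" and B :: "int set"
  assumes "finite Y" and "0 < s" and K: "8 / s\<^sup>2 \<le> real K"
    and far: "\<And>r. r \<in> B \<Longrightarrow> \<exists>c. \<forall>y\<in>Y. s \<le> norm (1 - e (y * of_int r - c))"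
    and close: "\<And>y z. y \<in> Y \<Longrightarrow> z \<in> Y \<Longrightarrow> real K * \<bar>y - z\<bar> < 1"
  shows "\<exists>C. \<forall>h n. real (card (B \<inter> {h + 1..h + int n})) * ((real (card Y))\<^sup>2 / 4)
                    \<le> (real K)\<^sup>2 * real (card Y) * real n + C"
proof -
  define P where "P = {..<K} \<times> {..<K} - Id"
  define S where "S = (\<lambda>p r. \<Sum>y\<in>Y. e ((real (fst p) - real (snd p)) * (of_int r * y)))"
  have cardP: "real (card P) \<le> (real K)\<^sup>2"
    unfolding P_def by (rule card_off_diagonal_le)
  have "\<exists>C. \<forall>h n. (\<Sum>r\<in>{h + 1..h + int n}. (norm (S p r))\<^sup>2) \<le> real (card Y) * real n + C"
    if "p \<in> P" for p
    unfolding S_def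
  proof (rule mean_square_window_le[OF assms(1)])
    fix y z assume yz: "y \<in> Y" "z \<in> Y" "y \<noteq> z"
    define q where "q = real (fst p) - real (snd p)"
    have q: "q \<noteq> 0" "\<bar>q\<bar> \<le> real K"
      using that by (auto simp: q_def P_def)
    have "\<bar>q * (y - z)\<bar> \<le> real K * \<bar>y - z\<bar>"
      using q(2) by (simp add: abs_mult mult_right_mono)
    then have "\<bar>q * (y - z)\<bar> < 1"
      using close[OF yz(1,2)] by simp
    moreover have "q * (y - z) \<noteq> 0" using q(1) yz(3) by simp
    ultimately have "q * (y - z) \<notin> \<int>"
      using Ints_nonzero_abs_less1 by blast
    then show "(real (fst p) - real (snd p)) * (y - z) \<notin> \<int>"
      by (simp add: q_def)
  qed
  then obtain C where C: "\<And>p h n. p \<in> P \<Longrightarrow>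
      (\<Sum>r\<in>{h + 1..h + int n}. (norm (S p r))\<^sup>2) \<le> real (card Y) * real n + C p"
    by metis
  have "real (card (B \<inter> {h + 1..h + int n})) * ((real (card Y))\<^sup>2 / 4)
      \<le> (real K)\<^sup>2 * real (card Y) * real n + (\<Sum>p\<in>P. C p)" for h :: int and n :: nat
  proof -
    have "real (card (B \<inter> {h + 1..h + int n})) * ((real (card Y))\<^sup>2 / 4)
        = (\<Sum>r\<in>B \<inter> {h + 1..h + int n}. (real (card Y))\<^sup>2 / 4)"
      by simp
    also have "\<dots> \<le> (\<Sum>r\<in>B \<inter> {h + 1..h + int n}. \<Sum>p\<in>P. (norm (S p r))\<^sup>2)"
    proof (rule sum_mono)
      fix r assume "r \<in> B \<inter> {h + 1..h + int n}"
      then obtain c where "\<forall>y\<in>Y. s \<le> norm (1 - e (y * of_int r - c))"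
        using far by blast
      then show "(real (card Y))\<^sup>2 / 4 \<le> (\<Sum>p\<in>P. (norm (S p r))\<^sup>2)"
        using card_square_le_sum_norm_square[OF assms(1,2) K, of "of_int r" c]
        by (simp add: P_def S_def case_prod_unfold)
    qed
    also have "\<dots> \<le> (\<Sum>r\<in>{h + 1..h + int n}. \<Sum>p\<in>P. (norm (S p r))\<^sup>2)"
      by (intro sum_mono2) (auto simp: sum_nonneg)
    also have "\<dots> = (\<Sum>p\<in>P. \<Sum>r\<in>{h + 1..h + int n}. (norm (S p r))\<^sup>2)"
      by (rule sum.swap)
    also have "\<dots> \<le> (\<Sum>p\<in>P. real (card Y) * real n + C p)"
      by (intro sum_mono C)
    also have "\<dots> = real (card P) * (real (card Y) * real n) + (\<Sum>p\<in>P. C p)"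
      by (simp add: sum.distrib)
    also have "\<dots> \<le> (real K)\<^sup>2 * (real (card Y) * real n) + (\<Sum>p\<in>P. C p)"
      using cardP by (simp add: mult_right_mono)
    finally show ?thesis by (simp add: mult_ac)
  qed
  then show ?thesis by blast
qed

section \<open>Dense windows\<close>

lemma positive_upper_Banach_densityE:
  assumes "upper_Banach_density A > 0"
  obtains d where "0 < d"
    and "\<And>N. \<exists>n h. N \<le> n \<and> d * real n \<le> real (card (A \<inter> {h + 1..h + int n}))"
proof -
  define M where "M = (\<lambda>n. Max (range (\<lambda>h. card (A \<inter> {h + 1..h + int n}))))"
  have pos: "0 < limsup (\<lambda>n. ereal (real (M n) / real n))"
    using assms by (simp add: upper_Banach_density_def M_def)
  then obtain d where d: "0 < ereal d" "ereal d < limsup (\<lambda>n. ereal (real (M n) / real n))"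
    using ereal_dense2 by blast
  have "\<exists>n h. N \<le> n \<and> d * real n \<le> real (card (A \<inter> {h + 1..h + int n}))" for N
  proof -
    \<comment> \<open>Asking for \<open>Suc N \<le> n\<close> below excludes the window of length 0.\<close>
    have "\<not> (\<forall>\<^sub>F n in sequentially. ereal (real (M n) / real n) \<le> ereal d)"
      using Limsup_bounded d(2) by (metis not_le)
    then obtain n where n: "Suc N \<le> n" "d < real (M n) / real n"
      unfolding eventually_sequentially by (metis ereal_less_eq(3) not_le)
    have "card (A \<inter> {h + 1..h + int n}) \<le> n" for h
      using card_mono[of "{h + 1..h + int n}" "A \<inter> {h + 1..h + int n}"] by simp
    then have "range (\<lambda>h. card (A \<inter> {h + 1..h + int n})) \<subseteq> {..n}" by auto
    then have "finite (range (\<lambda>h. card (A \<inter> {h + 1..h + int n})))"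
      by (rule finite_subset) simp
    then have "M n \<in> range (\<lambda>h. card (A \<inter> {h + 1..h + int n}))"
      unfolding M_def by (intro Max_in) auto
    then obtain h where "M n = card (A \<inter> {h + 1..h + int n})" by auto
    moreover have "d * real n \<le> real (M n)"
      using n by (simp add: field_simps)
    ultimately show ?thesis
      using n(1) by (intro exI[of _ n] exI[of _ h]) auto
  qed
  with d(1) show ?thesis using that by simp
qed

text \<open>Refining the scale by a factor \<open>L\<close> loses no elements, because \<open>\<lfloor>t\<rfloor>\<close> is recovered from
  \<open>\<lfloor>L * t\<rfloor>\<close> by integer division. The window becomes \<open>L\<close> times as long, so a density \<open>d\<close>
  becomes at least \<open>d / L\<close>, which remains positive.\<close>

lemma card_window_floor_le:
  fixes a :: "nat \<Rightarrow> real"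
  assumes "0 < L"
  shows "card (range (\<lambda>n. \<lfloor>a n\<rfloor>) \<inter> {h + 1..h + int n})
       \<le> card (range (\<lambda>n. \<lfloor>real L * a n\<rfloor>) \<inter>
            {(int L * (h + 1) - 1) + 1..(int L * (h + 1) - 1) + int (L * n)})"
    (is "card ?A \<le> card ?B")
proof (rule surj_card_le)
  show "?A \<subseteq> (\<lambda>r. r div int L) ` ?B"
  proof
    fix m assume "m \<in> ?A"
    then obtain k where k: "m = \<lfloor>a k\<rfloor>" "h + 1 \<le> m" "m \<le> h + int n" by auto
    define r where "r = \<lfloor>real L * a k\<rfloor>"
    have "m = r div int L"
      using floor_divide_real_eq_div[of "int L" "real L * a k"] assms k(1)
      by (simp add: r_def)
    then have "r = int L * m + r mod int L" by simp
    moreover have "0 \<le> r mod int L" "r mod int L < int L" using assms by simp_all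
    moreover have "int L * (h + 1) \<le> int L * m" "int L * m + int L \<le> int L * (h + 1) + int L * int n"
      using mult_left_mono[OF k(2), of "int L"] mult_left_mono[OF k(3), of "int L"]
      by (simp_all add: algebra_simps)
    ultimately have "int L * (h + 1) \<le> r" "r < int L * (h + 1) + int L * int n"
      by linarith+
    then have "r \<in> ?B"
      by (simp add: r_def)
    with \<open>m = r div int L\<close> show "m \<in> (\<lambda>r. r div int L) ` ?B" by blast
  qed
qed simp

lemma le_if_linear_le_unbounded:
  fixes u v C :: real
  assumes "\<And>N :: nat. \<exists>n\<ge>N. u * real n \<le> v * real n + C"
  shows "u \<le> v"
proof (rule ccontr)
  assume "\<not> u \<le> v"
  then have "0 < u - v" by simp
  obtain N :: nat where "C / (u - v) < real N" using reals_Archimedean2 by blast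
  moreover obtain n where "n \<ge> N" "u * real n \<le> v * real n + C" using assms by blast
  ultimately have "C / (u - v) < real n" by linarith
  then have "C < (u - v) * real n"
    using \<open>0 < u - v\<close> by (simp add: field_simps)
  then show False
    using \<open>u * real n \<le> _\<close> by (simp add: algebra_simps)
qed

section \<open>Finiteness in bounded intervals\<close>

lemma interval_of_lengthE:
  assumes "interval_of_length d I"
  obtains c where "\<And>t. \<bar>t - c\<bar> < d / 2 \<Longrightarrow> t \<in> I"
proof -
  obtain l u where "u - l = d" "{l<..<u} \<subseteq> I"
    using assms unfolding interval_of_length_def by fastforce
  moreover have "t \<in> {l<..<u}" if "u - l = d" "\<bar>t - (l + u) / 2\<bar> < d / 2" for t
    using that by (auto simp: abs_less_iff field_simps)
  ultimately show ?thesis using that by blast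
qed

text \<open>The constants are chosen in the order \<open>\<eta>\<close>, \<open>s\<close>, \<open>K\<close>, \<open>L\<close>: the margin \<open>\<eta>\<close> depends only on \<open>\<delta>\<close> and
  fixes \<open>s\<close> and \<open>K\<close>; then \<open>L\<close> is taken so large that the rounding error \<open>R / L\<close> is at most \<open>\<eta>\<close> and the
  rescaled points are closer than \<open>1 / K\<close> to each other. None of them depends on the finite subset
  \<open>F\<close>, so its cardinality is bounded uniformly.\<close>

lemma finite_avoiding_bounded:
  fixes a :: "nat \<Rightarrow> real" and \<Delta> :: "nat \<Rightarrow> real set"
  assumes dens: "upper_Banach_density (range (\<lambda>n. \<lfloor>a n\<rfloor>)) > 0"
    and \<delta>: "\<delta> > 0" and int: "\<And>n. interval_of_length \<delta> (\<Delta> n)"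
  shows "finite {x. \<bar>x\<bar> \<le> R \<and> (\<forall>n. a n * x \<notin> \<int> + \<Delta> n)}" (is "finite ?X")
proof -
  \<comment> \<open>The cap \<open>1 / 2\<close> keeps \<open>2 * pi * \<eta>\<close> in \<open>(0, \<pi>]\<close>, which makes \<open>s\<close> positive also when \<open>\<delta>\<close> is large.\<close>
  define \<eta> where "\<eta> = min (\<delta> / 4) (1 / 2)"
  define s where "s = 1 - cos (2 * pi * \<eta>)"
  have \<eta>: "0 < \<eta>" "\<eta> \<le> \<delta> / 4" "\<eta> \<le> 1 / 2" using \<delta> by (auto simp: \<eta>_def)
  have "cos (2 * pi * \<eta>) < cos 0"
    using \<eta> by (intro cos_monotone_0_pi) auto
  then have s: "0 < s" by (simp add: s_def)
  obtain K :: nat where K: "8 / s\<^sup>2 \<le> real K" using real_arch_simple by blast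
  obtain L0 :: nat where L0: "2 * real K * \<bar>R\<bar> + \<bar>R\<bar> / \<eta> \<le> real L0"
    using real_arch_simple by blast
  define L where "L = Suc L0"
  have L: "0 < L" "2 * real K * \<bar>R\<bar> < real L" "\<bar>R\<bar> / real L \<le> \<eta>"
  proof -
    have "0 \<le> \<bar>R\<bar> / \<eta>" "0 \<le> 2 * real K * \<bar>R\<bar>" using \<eta>(1) by auto
    then have "2 * real K * \<bar>R\<bar> < real L" "\<bar>R\<bar> / \<eta> \<le> real L"
      using L0 unfolding L_def of_nat_Suc by linarith+
    then show "0 < L" "2 * real K * \<bar>R\<bar> < real L" "\<bar>R\<bar> / real L \<le> \<eta>"
      using \<eta>(1) by (auto simp: L_def field_simps)
  qed
  define B where "B = range (\<lambda>n. \<lfloor>real L * a n\<rfloor>)"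
  have far: "\<exists>c. \<forall>x\<in>?X. s \<le> norm (1 - e (x / real L * of_int r - c))" if "r \<in> B" for r
  proof -
    obtain n where r: "r = \<lfloor>real L * a n\<rfloor>" using \<open>r \<in> B\<close> by (auto simp: B_def)
    obtain c where c: "\<And>t. \<bar>t - c\<bar> < \<delta> / 2 \<Longrightarrow> t \<in> \<Delta> n"
      using interval_of_lengthE[OF int] by blast
    have "s \<le> norm (1 - e (x / real L * of_int r - c))" if x: "x \<in> ?X" for x
      unfolding s_def
    proof (rule norm_one_minus_e_ge)
      fix k :: int
      have "\<delta> / 2 \<le> \<bar>a n * x - of_int k - c\<bar>"
      proof (rule ccontr)
        assume "\<not> ?thesis"
        then have "a n * x - of_int k \<in> \<Delta> n" using c by simp
        then have "of_int k + (a n * x - of_int k) \<in> \<int> + \<Delta> n" by (intro set_plus_intro) auto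
        then show False using x by simp
      qed
      moreover have "\<bar>a n * x - x / real L * of_int r\<bar> \<le> \<eta>"
      proof -
        have "a n * x - x / real L * of_int r = (real L * a n - of_int r) * (x / real L)"
          using L(1) by (simp add: field_simps)
        moreover have "\<bar>real L * a n - of_int r\<bar> \<le> 1" unfolding r by linarith
        moreover have "\<bar>x / real L\<bar> \<le> \<bar>R\<bar> / real L"
          using x L(1) by (auto simp: divide_right_mono)
        ultimately have "\<bar>a n * x - x / real L * of_int r\<bar> \<le> 1 * (\<bar>R\<bar> / real L)"
          unfolding abs_mult by (metis (no_types, lifting) abs_ge_zero abs_mult mult_mono zero_le_one)
        then show ?thesis using L(3) by simp
      qed
      ultimately show "\<eta> \<le> \<bar>x / real L * of_int r - c - of_int k\<bar>"
        using \<eta>(2) by linarith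
    qed (use \<eta> in simp)
    then show ?thesis by blast
  qed
  obtain d where d: "0 < d" and dense: "\<And>N. \<exists>n h. N \<le> n \<and>
      d * real n \<le> real (card (range (\<lambda>n. \<lfloor>a n\<rfloor>) \<inter> {h + 1..h + int n}))"
    using positive_upper_Banach_densityE[OF dens] by metis
  have bound: "real (card F) \<le> 4 * (real K)\<^sup>2 * real L / d" if F: "F \<subseteq> ?X" "finite F" for F
  proof (cases "card F = 0")
    case True
    then show ?thesis using d by simp
  next
    case False
    define Y where "Y = (\<lambda>x. x / real L) ` F"
    have cardY: "card Y = card F"
      unfolding Y_def using L(1) by (intro card_image) (auto simp: inj_on_def)
    have "\<exists>C. \<forall>h n. real (card (B \<inter> {h + 1..h + int n})) * ((real (card Y))\<^sup>2 / 4)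
                    \<le> (real K)\<^sup>2 * real (card Y) * real n + C"
    proof (rule card_window_avoiding_le[OF _ s K])
      show "finite Y" using F(2) by (simp add: Y_def)
      show "\<exists>c. \<forall>y\<in>Y. s \<le> norm (1 - e (y * of_int r - c))" if "r \<in> B" for r
        using far[OF that] F(1) unfolding Y_def by blast
      show "real K * \<bar>y - z\<bar> < 1" if yz: "y \<in> Y" "z \<in> Y" for y z
      proof -
        obtain x x' where xx: "x \<in> F" "x' \<in> F" "y = x / real L" "z = x' / real L"
          using yz unfolding Y_def by blast
        then have "\<bar>x\<bar> \<le> R" "\<bar>x'\<bar> \<le> R" using F(1) by auto
        then have "\<bar>x - x'\<bar> \<le> 2 * \<bar>R\<bar>" by linarith
        then have "real K * \<bar>x - x'\<bar> \<le> real K * (2 * \<bar>R\<bar>)" by (rule mult_left_mono) simp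
        moreover have "real K * \<bar>y - z\<bar> = real K * \<bar>x - x'\<bar> / real L"
          using L(1) by (simp add: xx diff_divide_distrib[symmetric])
        ultimately show ?thesis using L by (simp add: divide_less_eq)
      qed
    qed
    then obtain C where C: "\<And>h n. real (card (B \<inter> {h + 1..h + int n})) * ((real (card F))\<^sup>2 / 4)
                    \<le> (real K)\<^sup>2 * real (card F) * real n + C"
      unfolding cardY by blast
    have "d * ((real (card F))\<^sup>2 / 4) \<le> (real K)\<^sup>2 * real (card F) * real L"
    proof (rule le_if_linear_le_unbounded)
      fix N :: nat
      obtain n h where n: "N \<le> n"
        "d * real n \<le> real (card (range (\<lambda>n. \<lfloor>a n\<rfloor>) \<inter> {h + 1..h + int n}))"
        using dense by blast
      define h' where "h' = int L * (h + 1) - 1"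
      have "d * real n \<le> real (card (B \<inter> {h' + 1..h' + int (L * n)}))"
        using n(2) card_window_floor_le[OF L(1), of a h n] unfolding B_def h'_def by linarith
      then have "d * real n * ((real (card F))\<^sup>2 / 4)
          \<le> real (card (B \<inter> {h' + 1..h' + int (L * n)})) * ((real (card F))\<^sup>2 / 4)"
        by (rule mult_right_mono) simp
      also have "\<dots> \<le> (real K)\<^sup>2 * real (card F) * real (L * n) + C"
        by (rule C)
      finally show "\<exists>n\<ge>N. d * ((real (card F))\<^sup>2 / 4) * real n
          \<le> (real K)\<^sup>2 * real (card F) * real L * real n + C"
        using n(1) by (intro exI[of _ n]) (simp add: mult_ac)
    qed
    then have "real (card F) * (d * real (card F)) \<le> real (card F) * (4 * (real K)\<^sup>2 * real L)"
      by (simp add: power2_eq_square mult_ac)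
    then have "d * real (card F) \<le> 4 * (real K)\<^sup>2 * real L"
      using False by simp
    then show ?thesis using d by (simp add: field_simps)
  qed
  have "card F \<le> nat \<lfloor>4 * (real K)\<^sup>2 * real L / d\<rfloor>" if "F \<subseteq> ?X" "finite F" for F
    using bound[OF that] by (simp add: le_nat_floor)
  then show ?thesis
    using finite_if_finite_subsets_card_bdd by blast
qed

theorem theorem1p7:
  fixes a :: "nat \<Rightarrow> real" and \<delta> :: real and \<Delta> :: "nat \<Rightarrow> real set"
  assumes "strict_mono a"
    and "upper_Banach_density (range (\<lambda>n. \<lfloor>a n\<rfloor>)) > 0"
    and "\<delta> > 0"
    and "\<And>n. interval_of_length \<delta> (\<Delta> n)"
  shows "countable {x :: real. \<forall>n. a n * x \<notin> \<int> + \<Delta> n}"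
proof -
  have "{x. \<forall>n. a n * x \<notin> \<int> + \<Delta> n}
      = (\<Union>R :: nat. {x. \<bar>x\<bar> \<le> real R \<and> (\<forall>n. a n * x \<notin> \<int> + \<Delta> n)})"
    using real_arch_simple by blast
  then show ?thesis
    using finite_avoiding_bounded[OF assms(2-4)] by (simp add: countable_finite)
qed

end
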